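(* With respect to strong equivalence $\equiv_{s,a}$ of ASP programs: (1) the S-RP, S-DL and S-AD transformations are SE-preserving and NSE-preserving; (2) the S-RD-2 transformation is SE-preserving but not NSE-preserving; (3) the S-EX-1 transformation is NSE-preserving but not SE-preserving; (4) the S-RD-1 and S-EX-0 transformations are neither SE-preserving nor NSE-preserving.
   Context: Atoms are propositional. A rule $r$ is an expression $h_1\vee\cdots\vee h_k\leftarrow b_1,\dots,b_m,\mathit{not}\,c_1,\dots,\mathit{not}\,c_n$; write $H(r)$, $B^+(r)$, $B^-(r)$ for the sets of head, positive body and negative body atoms. A program is a finite set of rules. An interpretation $X$ satisfies $r$ iff $X\cap H(r)\neq\emptyset$ or $B^+(r)\not\subseteq X$ or $B^-(r)\cap X\neq\emptyset$. GL-reduct $P^X=\{H(r)\leftarrow B^+(r) : r\in P,\ B^-(r)\cap X=\emptyset\}$; $X$ is a stable model of $P$ iff $X\models P^X$ and no proper subset of $X$ satisfies $P^X$. $P\equiv_{s,a}Q$ iff for every program $R$, $P\cup R$ and $Q\cup R$ have the same stable models. Programs are regarded as tuples of rules (repetitions allowed); $\langle P,Q\rangle$ is the concatenation. For a tuple $T=\langle r_1,\dots,r_n\rangle$ with atom set $at(T)$, let $\langle S_1,\dots,S_{3n}\rangle=\langle H(r_1),B^+(r_1),B^-(r_1),\dots,H(r_n),B^+(r_n),B^-(r_n)\rangle$; for nonempty $N'\subseteq\{1,\dots,3n\}$ the independent set is $I_{N'}=\bigcap_{i\in N'}S_i\setminus\bigcup_{j\notin N'}S_j$. Let $I=I_{N'}$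 be an independent set and $a'\notin at(T)$ fresh. Replacing $a\in I$ by $a'$ renames every occurrence of $a$ in $T$; deleting $a\in I$ removes $a$ from every rule of $T$; adding $a'$ to $I$ adds $a'$ to each $S_i$, $i\in N'$. S-RP: replace some $a\in I$ by $a'$ ($|I|>0$); S-DL: delete some $a\in I$ ($|I|>2$); S-RD-$i$ ($i\in\{1,2\}$): delete some $a\in I$ ($|I|=i$); S-AD: add $a'$ to $I$ ($|I|\ge 2$); S-EX-$i$ ($i\in\{0,1\}$): add $a'$ to $I$ ($|I|=i$). For a pair $T=\langle P,Q\rangle$ the result is $\langle P^\circ,Q^\circ\rangle$ with $P^\circ$ the first $|P|$ rules. A transformation type is SE-preserving if for every pair $\langle P,Q\rangle$ and every admissible application $P\equiv_{s,a}Q$ implies $P^\circ\equiv_{s,a}Q^\circ$, and NSE-preserving if $P\not\equiv_{s,a}Q$ implies $P^\circ\not\equiv_{s,a}Q^\circ$. *)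

theory Defs
  imports Main "HOL-Library.FSet"
begin

(* Any of the three components may be empty; an empty head gives a constraint. *)
datatype 'a rule = Rule (head: "'a fset") (pos_body: "'a fset") (neg_body: "'a fset")

definition sat_rule :: "'a set \<Rightarrow> 'a rule \<Rightarrow> bool" where
  "sat_rule X r \<longleftrightarrow>
     X \<inter> fset (head r) \<noteq> {} \<or> \<not> fset (pos_body r) \<subseteq> X \<or> fset (neg_body r) \<inter> X \<noteq> {}"

definition sat :: "'a set \<Rightarrow> 'a rule set \<Rightarrow> bool" where
  "sat X P \<longleftrightarrow> (\<forall>r\<in>P. sat_rule X r)"

definition reduct :: "'a rule set \<Rightarrow> 'a set \<Rightarrow> 'a rule set" where
  "reduct P X = {Rule (head r) (pos_body r) {||} | r. r \<in> P \<and> fset (neg_body r) \<inter> X = {}}"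

definition stable_model :: "'a rule set \<Rightarrow> 'a set \<Rightarrow> bool" where
  "stable_model P X \<longleftrightarrow> sat X (reduct P X) \<and> \<not> (\<exists>Y. Y \<subset> X \<and> sat Y (reduct P X))"

definition strongly_equivalent :: "'a rule set \<Rightarrow> 'a rule set \<Rightarrow> bool" where
  "strongly_equivalent P Q \<longleftrightarrow>
     (\<forall>R. finite R \<longrightarrow> {X. stable_model (P \<union> R) X} = {X. stable_model (Q \<union> R) X})"

type_synonym 'a rules = "'a rule list"

definition atoms :: "'a rules \<Rightarrow> 'a set" where
  "atoms T = (\<Union>r\<in>set T. fset (head r) \<union> fset (pos_body r) \<union> fset (neg_body r))"

(* The sequence S_1, ..., S_{3n}, here indexed from 0: entries 3j, 3j+1, 3j+2 are the head,
   positive body and negative body of T ! j. *)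
definition components :: "'a rules \<Rightarrow> 'a fset list" where
  "components T = concat (map (\<lambda>r. [head r, pos_body r, neg_body r]) T)"

definition index_set :: "'a rules \<Rightarrow> nat set \<Rightarrow> bool" where
  "index_set T N \<longleftrightarrow> N \<noteq> {} \<and> N \<subseteq> {..<3 * length T}"

definition indep_set :: "'a rules \<Rightarrow> nat set \<Rightarrow> 'a set" where
  "indep_set T N = (\<Inter>i\<in>N. fset (components T ! i))
                   - (\<Union>j\<in>{..<3 * length T} - N. fset (components T ! j))"

definition replace_atom :: "'a \<Rightarrow> 'a \<Rightarrow> 'a rules \<Rightarrow> 'a rules" where
  "replace_atom a a' T =
     (let f = (\<lambda>x. if x = a then a' else x)
      in map (\<lambda>r. Rule (f |`| head r) (f |`| pos_body r) (f |`| neg_body r)) T)"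

definition delete_atom :: "'a \<Rightarrow> 'a rules \<Rightarrow> 'a rules" where
  "delete_atom a T =
     map (\<lambda>r. Rule (head r |-| {|a|}) (pos_body r |-| {|a|}) (neg_body r |-| {|a|})) T"

definition add_atom :: "'a \<Rightarrow> nat set \<Rightarrow> 'a rules \<Rightarrow> 'a rules" where
  "add_atom a' N T =
     (let ext = (\<lambda>i S. if i \<in> N then finsert a' S else S)
      in map (\<lambda>j. Rule (ext (3 * j) (head (T ! j)))
                       (ext (3 * j + 1) (pos_body (T ! j)))
                       (ext (3 * j + 2) (neg_body (T ! j)))) [0..<length T])"

(* A transformation type relates a tuple to each of its possible results. *)
type_synonym 'a transformation = "'a rules \<Rightarrow> 'a rules \<Rightarrow> bool"

(* In the definitions below, card is faithful because indep_set T N is finite whenever N is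
   nonempty. *)

definition S_RP :: "'a transformation" where
  "S_RP T T' \<longleftrightarrow> (\<exists>N a a'. index_set T N \<and> card (indep_set T N) > 0 \<and>
     a \<in> indep_set T N \<and> a' \<notin> atoms T \<and> T' = replace_atom a a' T)"

definition S_DL :: "'a transformation" where
  "S_DL T T' \<longleftrightarrow> (\<exists>N a. index_set T N \<and> card (indep_set T N) > 2 \<and>
     a \<in> indep_set T N \<and> T' = delete_atom a T)"

definition S_RD :: "nat \<Rightarrow> 'a transformation" where
  "S_RD i T T' \<longleftrightarrow> (\<exists>N a. index_set T N \<and> card (indep_set T N) = i \<and>
     a \<in> indep_set T N \<and> T' = delete_atom a T)"

definition S_AD :: "'a transformation" where
  "S_AD T T' \<longleftrightarrow> (\<exists>N a'. index_set T N \<and> card (indep_set T N) \<ge> 2 \<and>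
     a' \<notin> atoms T \<and> T' = add_atom a' N T)"

definition S_EX :: "nat \<Rightarrow> 'a transformation" where
  "S_EX i T T' \<longleftrightarrow> (\<exists>N a'. index_set T N \<and> card (indep_set T N) = i \<and>
     a' \<notin> atoms T \<and> T' = add_atom a' N T)"

definition SE_preserving :: "'a transformation \<Rightarrow> bool" where
  "SE_preserving \<tau> \<longleftrightarrow> (\<forall>P Q T'. \<tau> (P @ Q) T' \<longrightarrow>
     strongly_equivalent (set P) (set Q) \<longrightarrow>
     strongly_equivalent (set (take (length P) T')) (set (drop (length P) T')))"

definition NSE_preserving :: "'a transformation \<Rightarrow> bool" where
  "NSE_preserving \<tau> \<longleftrightarrow> (\<forall>P Q T'. \<tau> (P @ Q) T' \<longrightarrow>
     \<not> strongly_equivalent (set P) (set Q) \<longrightarrow>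
     \<not> strongly_equivalent (set (take (length P) T')) (set (drop (length P) T')))"

end

theory Submission
  imports Defs
begin

text \<open>
  Strong equivalence means having the same SE-models, i.e. the same pairs \<open>X \<subseteq> Y\<close> such that \<open>Y\<close>
  satisfies the program and \<open>X\<close> satisfies its reduct by \<open>Y\<close>. A rule sees an independent set \<open>I\<close> only
  through the four conditions \<open>I \<inter> X = {}\<close>, \<open>I \<subseteq> X\<close>, \<open>I \<inter> Y = {}\<close>, \<open>I \<subseteq> Y\<close>. All consistent
  combinations of these already occur when \<open>I\<close> has two elements, so that enlarging or shrinking \<open>I\<close>
  is harmless as long as two elements remain. A singleton realises only some of them, and for
  \<open>I = {}\<close> the conditions hold vacuously. Deleting an atom of \<open>I\<close> that has a twin amounts to renaming it to that twin, and
  adding a fresh atom is inverse to deleting it.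
\<close>

section \<open>SE-models\<close>

text \<open>For \<open>X \<subseteq> Y\<close> this is satisfaction in the logic of here-and-there,
  with \<open>X\<close> as the here-world and \<open>Y\<close> as the there-world.\<close>

definition ht_rule :: "'a set \<Rightarrow> 'a set \<Rightarrow> 'a rule \<Rightarrow> bool" where
  "ht_rule X Y r \<longleftrightarrow> sat_rule Y r \<and>
     (fset (neg_body r) \<inter> Y = {} \<longrightarrow> X \<inter> fset (head r) \<noteq> {} \<or> \<not> fset (pos_body r) \<subseteq> X)"

definition se_model :: "'a rule set \<Rightarrow> 'a set \<Rightarrow> 'a set \<Rightarrow> bool" where
  "se_model P X Y \<longleftrightarrow> (\<forall>r\<in>P. ht_rule X Y r)"

lemma se_model_Un: "se_model (P \<union> R) X Y \<longleftrightarrow> se_model P X Y \<and> se_model R X Y"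
  by (auto simp: se_model_def)

lemma se_model_diag: "se_model P X Y \<Longrightarrow> se_model P Y Y"
  by (auto simp: se_model_def ht_rule_def sat_rule_def)

text \<open>Stable models are equilibrium models. Once \<open>(Y, Y)\<close> is an SE-model, the
  conjunct \<open>sat_rule Y r\<close> of \<open>ht_rule\<close> holds for every rule, and what
  remains of \<open>ht_rule\<close> is satisfaction of the reduct.\<close>

lemma stable_model_iff_se_model:
  "stable_model P Y \<longleftrightarrow> se_model P Y Y \<and> (\<forall>X. X \<subset> Y \<longrightarrow> \<not> se_model P X Y)"
proof -
  have reduct: "reduct P Y =
      (\<lambda>r. Rule (head r) (pos_body r) {||}) ` {r \<in> P. fset (neg_body r) \<inter> Y = {}}"
    unfolding reduct_def by blast
  have sat: "sat X (reduct P Y) \<longleftrightarrow>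
      (\<forall>r\<in>P. fset (neg_body r) \<inter> Y = {} \<longrightarrow> X \<inter> fset (head r) \<noteq> {} \<or> \<not> fset (pos_body r) \<subseteq> X)" for X
    by (auto simp: reduct sat_def sat_rule_def)
  have diag: "sat Y (reduct P Y) \<longleftrightarrow> se_model P Y Y"
    unfolding sat se_model_def ht_rule_def sat_rule_def by blast
  have "sat X (reduct P Y) \<longleftrightarrow> se_model P X Y" if "se_model P Y Y" for X
    using that unfolding sat se_model_def ht_rule_def by blast
  then show ?thesis
    unfolding stable_model_def using diag by blast
qed

definition rule_atoms :: "'a rule \<Rightarrow> 'a set" where
  "rule_atoms r = fset (head r) \<union> fset (pos_body r) \<union> fset (neg_body r)"

text \<open>This cuts arbitrary interpretations down to finitely many atoms, so that they can be
  encoded by finite contexts.\<close>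

lemma ht_rule_restrict:
  assumes "rule_atoms r \<subseteq> A"
  shows "ht_rule (X \<inter> A) (Y \<inter> A) r \<longleftrightarrow> ht_rule X Y r"
  using assms unfolding ht_rule_def sat_rule_def rule_atoms_def by blast

text \<open>From a pair that is an SE-model of \<open>P\<close> only, a context \<open>R\<close> is
  built for which exactly one of \<open>P \<union> R\<close> and \<open>Q \<union> R\<close> has the
  stable model \<open>Y\<close>. Finiteness of \<open>Y\<close> makes \<open>R\<close> an admissible
  context.\<close>

lemma se_model_finite_subset:
  assumes se: "strongly_equivalent P Q" and fin: "finite Y" and sub: "X \<subseteq> Y"
    and P: "se_model P X Y"
  shows "se_model Q X Y"
proof (rule ccontr)
  assume Q: "\<not> se_model Q X Y"
  have stable: "stable_model (P \<union> R) Y \<longleftrightarrow> stable_model (Q \<union> R) Y" if "finite R" for R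
    using se that unfolding strongly_equivalent_def by blast
  show False
  proof (cases "se_model Q Y Y")
    case False
    \<comment> \<open>With all atoms of \<open>Y\<close> as facts nothing strictly below
      \<open>Y\<close> survives, so stability of \<open>Y\<close> reduces to \<open>(Y, Y)\<close>
      being an SE-model.\<close>
    define R where "R = (\<lambda>y. Rule {|y|} {||} {||}) ` Y"
    have R: "se_model R Z Y \<longleftrightarrow> Y \<subseteq> Z" for Z
      by (auto simp: R_def se_model_def ht_rule_def sat_rule_def)
    have "stable_model (P \<union> R) Y"
      using se_model_diag[OF P] by (auto simp: stable_model_iff_se_model se_model_Un R)
    moreover have "\<not> stable_model (Q \<union> R) Y"
      using False by (auto simp: stable_model_iff_se_model se_model_Un)
    ultimately show False
      using stable[of R] fin by (simp add: R_def)
  next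
    case True
    with Q sub have psub: "X \<subset> Y" by auto
    \<comment> \<open>The facts \<open>X\<close> and a cycle through \<open>Y - X\<close> leave only \<open>X\<close> and \<open>Y\<close> as candidates below \<open>Y\<close>.\<close>
    define R where "R = (\<lambda>x. Rule {|x|} {||} {||}) ` X
      \<union> (\<lambda>(y, z). Rule {|y|} {|z|} {||}) ` ((Y - X) \<times> (Y - X))"
    have R: "se_model R Z Y \<longleftrightarrow> Z = X \<or> Z = Y" if "Z \<subseteq> Y" for Z
    proof -
      have "se_model R Z Y \<longleftrightarrow> (\<forall>x\<in>X. ht_rule Z Y (Rule {|x|} {||} {||})) \<and>
          (\<forall>y\<in>Y - X. \<forall>z\<in>Y - X. ht_rule Z Y (Rule {|y|} {|z|} {||}))"
        by (simp add: R_def se_model_def ball_Un split_paired_Ball_Sigma)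
      also have "\<dots> \<longleftrightarrow> X \<subseteq> Z \<and> (\<forall>y\<in>Y - X. \<forall>z\<in>Y - X. z \<in> Z \<longrightarrow> y \<in> Z)"
        using sub by (auto simp: ht_rule_def sat_rule_def)
      finally have "se_model R Z Y \<longleftrightarrow> X \<subseteq> Z \<and> (\<forall>y\<in>Y - X. \<forall>z\<in>Y - X. z \<in> Z \<longrightarrow> y \<in> Z)" .
      with that sub show ?thesis by blast
    qed
    \<comment> \<open>The roles are swapped against the first case: \<open>X\<close>, the only rival
      of \<open>Y\<close>, is excluded by \<open>Q\<close> but destroys the minimality of
      \<open>Y\<close> under \<open>P\<close>.\<close>
    have "stable_model (Q \<union> R) Y"
      using True Q R by (auto simp: stable_model_iff_se_model se_model_Un)
    moreover have "\<not> stable_model (P \<union> R) Y"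
      using P R[OF sub] psub by (auto simp: stable_model_iff_se_model se_model_Un)
    moreover have "finite R"
      using fin finite_subset[OF sub fin] by (simp add: R_def)
    ultimately show False
      using stable[of R] by simp
  qed
qed

lemma strongly_equivalent_sym: "strongly_equivalent P Q \<Longrightarrow> strongly_equivalent Q P"
  by (simp add: strongly_equivalent_def)

text \<open>Left to right, restricting to the finitely many atoms of both programs reduces
  everything to finite \<open>Y\<close>. Right to left, stability depends on the SE-models alone,
  and those of a union are the common ones.\<close>

theorem strongly_equivalent_iff_se_model:
  assumes "finite P" "finite Q"
  shows "strongly_equivalent P Q \<longleftrightarrow> (\<forall>X Y. X \<subseteq> Y \<longrightarrow> se_model P X Y = se_model Q X Y)"
proof
  assume se: "strongly_equivalent P Q"
  define A where "A = (\<Union>r\<in>P \<union> Q. rule_atoms r)"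
  have fin: "finite A"
    using assms by (simp add: A_def rule_atoms_def)
  have restrict: "se_model R (X \<inter> A) (Y \<inter> A) \<longleftrightarrow> se_model R X Y" if "R \<subseteq> P \<union> Q" for R X Y
  proof -
    have "ht_rule (X \<inter> A) (Y \<inter> A) r \<longleftrightarrow> ht_rule X Y r" if "r \<in> R" for r
      using that \<open>R \<subseteq> P \<union> Q\<close> by (intro ht_rule_restrict) (auto simp: A_def)
    then show ?thesis by (simp add: se_model_def)
  qed
  show "\<forall>X Y. X \<subseteq> Y \<longrightarrow> se_model P X Y = se_model Q X Y"
  proof (intro allI impI)
    fix X Y :: "'a set" assume "X \<subseteq> Y"
    then have "X \<inter> A \<subseteq> Y \<inter> A" "finite (Y \<inter> A)"
      using fin by auto
    then have "se_model P (X \<inter> A) (Y \<inter> A) = se_model Q (X \<inter> A) (Y \<inter> A)"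
      using se_model_finite_subset[OF se] se_model_finite_subset[OF strongly_equivalent_sym[OF se]]
      by blast
    then show "se_model P X Y = se_model Q X Y"
      by (simp add: restrict)
  qed
next
  assume "\<forall>X Y. X \<subseteq> Y \<longrightarrow> se_model P X Y = se_model Q X Y"
  then show "strongly_equivalent P Q"
    by (auto simp: strongly_equivalent_def stable_model_iff_se_model se_model_Un psubset_eq)
qed

text \<open>A simulation principle: one pair \<open>(U, V)\<close> has to mimic
  \<open>(X, Y)\<close> on all rules simultaneously. Taking the identity for \<open>f\<close> or for
  \<open>g\<close> yields preservation in one direction or the other.\<close>

lemma strongly_equivalent_transfer:
  assumes "finite P" "finite Q" "strongly_equivalent (f ` P) (f ` Q)"
    and sim: "\<And>X Y. X \<subseteq> Y \<Longrightarrow>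
      \<exists>U V. U \<subseteq> V \<and> (\<forall>r\<in>P \<union> Q. ht_rule U V (f r) = ht_rule X Y (g r))"
  shows "strongly_equivalent (g ` P) (g ` Q)"
proof -
  have "se_model (g ` P) X Y = se_model (g ` Q) X Y" if XY: "X \<subseteq> Y" for X Y
  proof -
    obtain U V where UV: "U \<subseteq> V" "\<forall>r\<in>P \<union> Q. ht_rule U V (f r) = ht_rule X Y (g r)"
      using sim[OF XY] by blast
    have "se_model (g ` R) X Y = se_model (f ` R) U V" if "R \<subseteq> P \<union> Q" for R
      using UV(2) that by (auto simp: se_model_def)
    moreover have "se_model (f ` P) U V = se_model (f ` Q) U V"
      using assms(1-3) UV(1) by (simp add: strongly_equivalent_iff_se_model)
    ultimately show ?thesis by simp
  qed
  with assms(1,2) show ?thesis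
    by (simp add: strongly_equivalent_iff_se_model)
qed

section \<open>Renaming and deleting atoms\<close>

definition rename_rule :: "('a \<Rightarrow> 'a) \<Rightarrow> 'a rule \<Rightarrow> 'a rule" where
  "rename_rule f r = Rule (f |`| head r) (f |`| pos_body r) (f |`| neg_body r)"

definition delete_rule :: "'a \<Rightarrow> 'a rule \<Rightarrow> 'a rule" where
  "delete_rule a r = Rule (head r |-| {|a|}) (pos_body r |-| {|a|}) (neg_body r |-| {|a|})"

lemma replace_atom_eq_map: "replace_atom a a' = map (rename_rule (\<lambda>x. if x = a then a' else x))"
  by (rule ext) (simp add: replace_atom_def rename_rule_def Let_def)

lemma delete_atom_eq_map: "delete_atom a = map (delete_rule a)"
  by (rule ext) (simp add: delete_atom_def delete_rule_def)

text \<open>Renaming a rule amounts to pulling the interpretations back along \<open>f\<close>. As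
  \<open>f\<close> may merge atoms, this also serves for deleting a twin.\<close>

lemma ht_rule_rename: "ht_rule X Y (rename_rule f r) \<longleftrightarrow> ht_rule (f -` X) (f -` Y) r"
  unfolding ht_rule_def sat_rule_def rename_rule_def by auto

lemma strongly_equivalent_rename:
  assumes "finite P" "finite Q" "strongly_equivalent P Q"
  shows "strongly_equivalent (rename_rule f ` P) (rename_rule f ` Q)"
proof (rule strongly_equivalent_transfer[where f = "\<lambda>r. r"])
  fix X Y :: "'a set" assume "X \<subseteq> Y"
  then show "\<exists>U V. U \<subseteq> V \<and> (\<forall>r\<in>P \<union> Q. ht_rule U V r = ht_rule X Y (rename_rule f r))"
    by (intro exI[of _ "f -` X"] exI[of _ "f -` Y"]) (auto simp: ht_rule_rename)
qed (use assms in simp_all)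

definition twin :: "'a \<Rightarrow> 'a \<Rightarrow> 'a rule \<Rightarrow> bool" where
  "twin a b r \<longleftrightarrow> (a |\<in>| head r \<longleftrightarrow> b |\<in>| head r) \<and> (a |\<in>| pos_body r \<longleftrightarrow> b |\<in>| pos_body r) \<and>
     (a |\<in>| neg_body r \<longleftrightarrow> b |\<in>| neg_body r)"

text \<open>Wherever \<open>a\<close> occurs, \<open>b\<close> is already present, so sending
  \<open>a\<close> to \<open>b\<close> merely makes \<open>a\<close> vanish.\<close>

lemma delete_rule_eq_rename_rule:
  assumes "twin a b r" "a \<noteq> b"
  shows "delete_rule a r = rename_rule (\<lambda>x. if x = a then b else x) r"
proof -
  have "S |-| {|a|} = (\<lambda>x. if x = a then b else x) |`| S" if "a |\<in>| S \<longleftrightarrow> b |\<in>| S" for S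
    using that assms(2) by (auto simp: fset_eq_iff image_iff)
  with assms(1) show ?thesis
    by (simp add: delete_rule_def rename_rule_def twin_def)
qed

lemma strongly_equivalent_delete_twin:
  assumes "finite P" "finite Q" "strongly_equivalent P Q"
    and "a \<noteq> b" "\<And>r. r \<in> P \<union> Q \<Longrightarrow> twin a b r"
  shows "strongly_equivalent (delete_rule a ` P) (delete_rule a ` Q)"
proof -
  let ?f = "\<lambda>x. if x = a then b else x"
  have "delete_rule a ` R = rename_rule ?f ` R" if "R \<subseteq> P \<union> Q" for R
    using that assms(4,5) by (intro image_cong) (auto intro: delete_rule_eq_rename_rule)
  with strongly_equivalent_rename[OF assms(1-3), of ?f] show ?thesis
    by simp
qed

text \<open>
  Records on \<open>b\<close> and \<open>c\<close> alone whether \<open>Z\<close> meets and whether it contains \<open>{a, b, c}\<close>.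
\<close>

definition squeeze :: "'a \<Rightarrow> 'a \<Rightarrow> 'a \<Rightarrow> 'a set \<Rightarrow> 'a set" where
  "squeeze a b c Z = {x. if x = b then a \<in> Z \<or> b \<in> Z \<or> c \<in> Z
                         else if x = c then a \<in> Z \<and> b \<in> Z \<and> c \<in> Z else x \<in> Z}"

text \<open>A component \<open>S\<close> is consulted only through disjointness and inclusion, and
  it contains all of \<open>a\<close>, \<open>b\<close>, \<open>c\<close> or none. In the first case
  \<open>b\<close> answers for meeting the triple and \<open>c\<close> for containing it, so both
  tests come out alike on \<open>S\<close> without \<open>a\<close>.\<close>

lemma ht_rule_squeeze:
  assumes "a \<noteq> b" "a \<noteq> c" "b \<noteq> c" "twin a b r" "twin a c r"
  shows "ht_rule (squeeze a b c X) (squeeze a b c Y) (delete_rule a r) \<longleftrightarrow> ht_rule X Y r"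
proof -
  have agree: "x \<in> squeeze a b c Z \<longleftrightarrow> x \<in> Z" if "x \<noteq> b" "x \<noteq> c" for x Z
    using that by (simp add: squeeze_def)
  have b: "b \<in> squeeze a b c Z \<longleftrightarrow> a \<in> Z \<or> b \<in> Z \<or> c \<in> Z"
    and c: "c \<in> squeeze a b c Z \<longleftrightarrow> a \<in> Z \<and> b \<in> Z \<and> c \<in> Z" for Z
    using assms(3) by (simp_all add: squeeze_def)
  \<comment> \<open>Disjointness is stated in both orders because heads stand to the right of the
    intersection in \<open>sat_rule\<close> and \<open>ht_rule\<close>, negative bodies to the left;
    the closing \<open>simp only\<close> needs literal matches.\<close>
  have *: "(squeeze a b c Z \<inter> (fset S - {a}) = {} \<longleftrightarrow> Z \<inter> fset S = {}) \<and>
      ((fset S - {a}) \<inter> squeeze a b c Z = {} \<longleftrightarrow> fset S \<inter> Z = {}) \<and>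
      (fset S - {a} \<subseteq> squeeze a b c Z \<longleftrightarrow> fset S \<subseteq> Z)"
    if twins: "a |\<in>| S \<longleftrightarrow> b |\<in>| S" "a |\<in>| S \<longleftrightarrow> c |\<in>| S" for S Z
  proof (cases "a |\<in>| S")
    case True
    define W where "W = fset S - {a, b, c}"
    have S: "fset S = {a, b, c} \<union> W" "fset S - {a} = {b, c} \<union> W"
      using True twins assms(1-3) by (auto simp: W_def)
    have "x \<in> squeeze a b c Z \<longleftrightarrow> x \<in> Z" if "x \<in> W" for x
      using that agree by (simp add: W_def)
    then have W: "squeeze a b c Z \<inter> W = {} \<longleftrightarrow> Z \<inter> W = {}" "W \<subseteq> squeeze a b c Z \<longleftrightarrow> W \<subseteq> Z"
      by blast+
    have "squeeze a b c Z \<inter> (fset S - {a}) = {} \<longleftrightarrow>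
        b \<notin> squeeze a b c Z \<and> c \<notin> squeeze a b c Z \<and> squeeze a b c Z \<inter> W = {}"
      unfolding S(2) by blast
    also have "\<dots> \<longleftrightarrow> a \<notin> Z \<and> b \<notin> Z \<and> c \<notin> Z \<and> Z \<inter> W = {}"
      unfolding W b c by blast
    also have "\<dots> \<longleftrightarrow> Z \<inter> fset S = {}"
      unfolding S(1) by blast
    finally have "squeeze a b c Z \<inter> (fset S - {a}) = {} \<longleftrightarrow> Z \<inter> fset S = {}" .
    moreover have "fset S - {a} \<subseteq> squeeze a b c Z \<longleftrightarrow> fset S \<subseteq> Z"
      unfolding S(2) unfolding S(1) by (auto simp: b c W)
    ultimately show ?thesis
      by (simp only: Int_commute simp_thms)
  next
    case False
    with twins have "x \<noteq> a \<and> x \<noteq> b \<and> x \<noteq> c" if "x \<in> fset S" for x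
      using that by auto
    with agree have "x \<noteq> a \<and> (x \<in> squeeze a b c Z \<longleftrightarrow> x \<in> Z)" if "x \<in> fset S" for x
      using that by simp
    then show ?thesis by blast
  qed
  have twins: "a |\<in>| head r \<longleftrightarrow> b |\<in>| head r" "a |\<in>| head r \<longleftrightarrow> c |\<in>| head r"
    "a |\<in>| pos_body r \<longleftrightarrow> b |\<in>| pos_body r" "a |\<in>| pos_body r \<longleftrightarrow> c |\<in>| pos_body r"
    "a |\<in>| neg_body r \<longleftrightarrow> b |\<in>| neg_body r" "a |\<in>| neg_body r \<longleftrightarrow> c |\<in>| neg_body r"
    using assms(4,5) by (simp_all only: twin_def)
  show ?thesis
    unfolding ht_rule_def sat_rule_def delete_rule_def
    by (simp only: rule.sel minus_fset.rep_eq finsert.rep_eq bot_fset.rep_eq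
        *[OF twins(1,2)] *[OF twins(3,4)] *[OF twins(5,6)])
qed

text \<open>After \<open>a\<close> is gone, two atoms remain to carry the two bits of
  \<open>squeeze\<close>. Its monotonicity in \<open>Z\<close> keeps the simulating pair
  ordered.\<close>

lemma strongly_equivalent_of_delete_twins:
  assumes "finite P" "finite Q" "strongly_equivalent (delete_rule a ` P) (delete_rule a ` Q)"
    and "a \<noteq> b" "a \<noteq> c" "b \<noteq> c"
    and "\<And>r. r \<in> P \<union> Q \<Longrightarrow> twin a b r \<and> twin a c r"
  shows "strongly_equivalent P Q"
proof -
  have "strongly_equivalent ((\<lambda>r. r) ` P) ((\<lambda>r. r) ` Q)"
  proof (rule strongly_equivalent_transfer[where f = "delete_rule a"])
    fix X Y :: "'a set" assume "X \<subseteq> Y"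
    then have "squeeze a b c X \<subseteq> squeeze a b c Y"
      by (auto simp: squeeze_def)
    moreover have "\<forall>r\<in>P \<union> Q.
        ht_rule (squeeze a b c X) (squeeze a b c Y) (delete_rule a r) = ht_rule X Y r"
      using assms(4-7) by (simp add: ht_rule_squeeze)
    ultimately show
      "\<exists>U V. U \<subseteq> V \<and> (\<forall>r\<in>P \<union> Q. ht_rule U V (delete_rule a r) = ht_rule X Y r)"
      by blast
  qed (use assms in simp_all)
  then show ?thesis by simp
qed

section \<open>Independent sets\<close>

lemma length_components [simp]: "length (components T) = 3 * length T"
  by (induction T) (simp_all add: components_def)

lemma components_nth:
  assumes "j < length T"
  shows "components T ! (3 * j) = head (T ! j)"
    "components T ! Suc (3 * j) = pos_body (T ! j)"
    "components T ! Suc (Suc (3 * j)) = neg_body (T ! j)"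
  using assms
proof (induction T arbitrary: j)
  case (Cons r T)
  {
    case 1 with Cons.IH show ?case by (cases j) (simp_all add: components_def)
  next
    case 2 with Cons.IH show ?case by (cases j) (simp_all add: components_def)
  next
    case 3 with Cons.IH show ?case by (cases j) (simp_all add: components_def)
  }
qed simp_all

lemma in_set_components:
  assumes "r \<in> set T"
  shows "head r \<in> set (components T)" "pos_body r \<in> set (components T)"
    "neg_body r \<in> set (components T)"
  using assms by (auto simp: components_def)

text \<open>A component with index in \<open>N\<close> contains the whole independent set, any other
  component avoids it entirely.\<close>

lemma twin_if_indep_set:
  assumes "a \<in> indep_set T N" "b \<in> indep_set T N" "r \<in> set T"
  shows "twin a b r"
proof -
  have "a |\<in>| S \<longleftrightarrow> b |\<in>| S" if S: "S \<in> set (components T)" for S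
  proof -
    obtain i where "i < 3 * length T" "S = components T ! i"
      using S by (auto simp: in_set_conv_nth)
    then show ?thesis
      using assms(1,2) by (cases "i \<in> N") (auto simp: indep_set_def)
  qed
  then show ?thesis
    using in_set_components[OF assms(3)] by (simp add: twin_def)
qed

lemma finite_indep_set:
  assumes "index_set T N"
  shows "finite (indep_set T N)"
proof -
  obtain i where "i \<in> N"
    using assms by (auto simp: index_set_def)
  then have "indep_set T N \<subseteq> fset (components T ! i)"
    by (auto simp: indep_set_def)
  then show ?thesis
    by (rule finite_subset) simp
qed

lemma atoms_eq_components: "atoms T = (\<Union>S\<in>set (components T). fset S)"
  by (auto simp: atoms_def components_def)

lemma indep_set_subset_atoms:
  assumes "index_set T N"
  shows "indep_set T N \<subseteq> atoms T"
proof -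
  obtain i where i: "i \<in> N" "i < 3 * length T"
    using assms by (auto simp: index_set_def)
  then have "indep_set T N \<subseteq> fset (components T ! i)"
    by (auto simp: indep_set_def)
  also have "\<dots> \<subseteq> atoms T"
    using i unfolding atoms_eq_components by (intro UN_upper nth_mem) simp
  finally show ?thesis .
qed

lemma length_add_atom [simp]: "length (add_atom a N T) = length T"
  by (simp add: add_atom_def Let_def)

lemma delete_atom_add_atom:
  assumes "a \<notin> atoms T"
  shows "delete_atom a (add_atom a N T) = T"
proof (rule nth_equalityI)
  fix j assume "j < length (delete_atom a (add_atom a N T))"
  then have j: "j < length T"
    by (simp add: delete_atom_eq_map)
  then have "T ! j \<in> set T"
    by simp
  with assms have "a |\<notin>| head (T ! j)" "a |\<notin>| pos_body (T ! j)" "a |\<notin>| neg_body (T ! j)"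
    by (auto simp: atoms_def)
  with j show "delete_atom a (add_atom a N T) ! j = T ! j"
    by (auto simp: delete_atom_def add_atom_def Let_def intro!: rule.expand)
qed (simp add: delete_atom_eq_map)

lemma components_add_atom_nth:
  assumes "i < 3 * length T"
  shows "components (add_atom a N T) ! i =
    (if i \<in> N then finsert a (components T ! i) else components T ! i)"
proof -
  \<comment> \<open>\<open>j\<close> is the rule to which component \<open>i\<close> belongs; the
    remainder modulo 3 tells head, positive body and negative body apart.\<close>
  define j where "j = i div 3"
  have j: "j < length T"
    using assms by (simp add: j_def less_mult_imp_div_less mult.commute)
  have "i = 3 * j \<or> i = Suc (3 * j) \<or> i = Suc (Suc (3 * j))"
    unfolding j_def by presburger
  with j show ?thesis
    by (auto simp: components_nth add_atom_def Let_def)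
qed

text \<open>The fresh atom enters exactly the components selected by \<open>N\<close>: it joins
  their intersection and stays out of everything subtracted.\<close>

lemma indep_set_add_atom:
  assumes "a \<notin> atoms T" "index_set T N"
  shows "indep_set (add_atom a N T) N = insert a (indep_set T N)"
proof -
  have N: "N \<subseteq> {..<3 * length T}" "N \<noteq> {}"
    using assms(2) by (auto simp: index_set_def)
  have fresh: "a |\<notin>| components T ! i" if "i < 3 * length T" for i
    using assms(1) that by (auto simp: atoms_eq_components)
  have "(\<Inter>i\<in>N. fset (components (add_atom a N T) ! i)) =
      insert a (\<Inter>i\<in>N. fset (components T ! i))"
    using N by (auto simp: components_add_atom_nth subset_iff)
  moreover have "(\<Union>j\<in>{..<3 * length T} - N. fset (components (add_atom a N T) ! j)) =
      (\<Union>j\<in>{..<3 * length T} - N. fset (components T ! j))"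
    by (auto simp: components_add_atom_nth)
  ultimately show ?thesis
    using fresh by (auto simp: indep_set_def)
qed

lemma card_indep_set_add_atom:
  assumes "a \<notin> atoms T" "index_set T N"
  shows "card (indep_set (add_atom a N T) N) = Suc (card (indep_set T N))"
  using assms indep_set_subset_atoms[OF assms(2)] finite_indep_set[OF assms(2)]
  by (subst indep_set_add_atom) (auto intro!: card_insert_disjoint)

section \<open>Preservation\<close>

text \<open>A transformation acting rule by rule commutes with splitting the tuple, so the two parts
  of \<open>T'\<close> are the images of the original programs. The map \<open>g\<close> depends on
  the whole tuple, not on where it is split.\<close>

lemma map_SE_preservingI:
  assumes "\<And>T T'. \<tau> T T' \<Longrightarrow> \<exists>g. T' = map g T \<and>
    (\<forall>P Q. set T = P \<union> Q \<longrightarrow> strongly_equivalent P Q \<longrightarrow> strongly_equivalent (g ` P) (g ` Q))"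
  shows "SE_preserving \<tau>"
  unfolding SE_preserving_def
proof (intro allI impI)
  fix P Q T' assume "\<tau> (P @ Q) T'" "strongly_equivalent (set P) (set Q)"
  then show "strongly_equivalent (set (take (length P) T')) (set (drop (length P) T'))"
    using assms[of "P @ Q" T'] by auto
qed

lemma map_NSE_preservingI:
  assumes "\<And>T T'. \<tau> T T' \<Longrightarrow> \<exists>g. T' = map g T \<and>
    (\<forall>P Q. set T = P \<union> Q \<longrightarrow> strongly_equivalent (g ` P) (g ` Q) \<longrightarrow> strongly_equivalent P Q)"
  shows "NSE_preserving \<tau>"
  unfolding NSE_preserving_def
proof (intro allI impI)
  fix P Q T' assume "\<tau> (P @ Q) T'" "\<not> strongly_equivalent (set P) (set Q)"
  then show "\<not> strongly_equivalent (set (take (length P) T')) (set (drop (length P) T'))"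
    using assms[of "P @ Q" T'] by auto
qed

text \<open>If every \<open>\<tau>\<close> step is undone by a \<open>\<sigma>\<close> step,
  SE-preservation of \<open>\<tau>\<close> is the contrapositive of NSE-preservation of
  \<open>\<sigma>\<close>. Equal lengths ensure that both steps split the tuple at the same
  place.\<close>

lemma SE_preserving_converse:
  assumes "NSE_preserving \<sigma>" and conv: "\<And>T T'. \<tau> T T' \<Longrightarrow> \<sigma> T' T \<and> length T' = length T"
  shows "SE_preserving \<tau>"
  unfolding SE_preserving_def
proof (intro allI impI)
  fix P Q T' assume \<tau>: "\<tau> (P @ Q) T'" and se: "strongly_equivalent (set P) (set Q)"
  have "\<sigma> (take (length P) T' @ drop (length P) T') (P @ Q)" "length (take (length P) T') = length P"
    using conv[OF \<tau>] by simp_all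
  with assms(1) se show "strongly_equivalent (set (take (length P) T')) (set (drop (length P) T'))"
    unfolding NSE_preserving_def by fastforce
qed

lemma NSE_preserving_converse:
  assumes "SE_preserving \<sigma>" and conv: "\<And>T T'. \<tau> T T' \<Longrightarrow> \<sigma> T' T \<and> length T' = length T"
  shows "NSE_preserving \<tau>"
  unfolding NSE_preserving_def
proof (intro allI impI)
  fix P Q T' assume \<tau>: "\<tau> (P @ Q) T'" and se: "\<not> strongly_equivalent (set P) (set Q)"
  have "\<sigma> (take (length P) T' @ drop (length P) T') (P @ Q)" "length (take (length P) T') = length P"
    using conv[OF \<tau>] by simp_all
  with assms(1) se show "\<not> strongly_equivalent (set (take (length P) T')) (set (drop (length P) T'))"
    unfolding SE_preserving_def by fastforce
qed

lemma SE_preserving_S_RP: "SE_preserving S_RP"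
proof (rule map_SE_preservingI)
  fix T T' :: "'a rules" assume "S_RP T T'"
  then obtain a a' where "T' = map (rename_rule (\<lambda>x. if x = a then a' else x)) T"
    by (auto simp: S_RP_def replace_atom_eq_map)
  moreover have "finite P \<and> finite Q" if "set T = P \<union> Q" for P Q
    using that by (metis List.finite_set finite_Un)
  ultimately show "\<exists>g. T' = map g T \<and> (\<forall>P Q. set T = P \<union> Q \<longrightarrow> strongly_equivalent P Q \<longrightarrow>
      strongly_equivalent (g ` P) (g ` Q))"
    by (intro exI[of _ "rename_rule (\<lambda>x. if x = a then a' else x)"])
      (simp add: strongly_equivalent_rename)
qed

lemma NSE_preserving_S_RP: "NSE_preserving S_RP"
proof (rule map_NSE_preservingI)
  fix T T' :: "'a rules" assume "S_RP T T'"
  then obtain a a' where fresh: "a' \<notin> atoms T"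
    and T': "T' = map (rename_rule (\<lambda>x. if x = a then a' else x)) T"
    by (auto simp: S_RP_def replace_atom_eq_map)
  \<comment> \<open>Since \<open>a'\<close> is fresh, \<open>?g\<close> undoes \<open>?f\<close> on
    every rule of \<open>T\<close>; renaming back then recovers \<open>P\<close> and
    \<open>Q\<close>.\<close>
  let ?f = "\<lambda>x. if x = a then a' else x" and ?g = "\<lambda>x. if x = a' then a else x"
  have inv: "rename_rule ?g (rename_rule ?f r) = r" if "r \<in> set T" for r
  proof -
    have "?g |`| ?f |`| S = S" if "a' |\<notin>| S" for S
      using that by (auto simp: fset_eq_iff image_iff)
    moreover have "a' |\<notin>| head r" "a' |\<notin>| pos_body r" "a' |\<notin>| neg_body r"
      using fresh that by (auto simp: atoms_def)
    ultimately show ?thesis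
      by (simp add: rename_rule_def)
  qed
  have "strongly_equivalent P Q"
    if T: "set T = P \<union> Q" and se: "strongly_equivalent (rename_rule ?f ` P) (rename_rule ?f ` Q)"
    for P Q
  proof -
    have "finite P" "finite Q"
      using T by (metis List.finite_set finite_Un)+
    then have "strongly_equivalent (rename_rule ?g ` rename_rule ?f ` P)
        (rename_rule ?g ` rename_rule ?f ` Q)"
      by (intro strongly_equivalent_rename[OF _ _ se]) simp_all
    moreover have "rename_rule ?g ` rename_rule ?f ` R = R" if "R \<subseteq> P \<union> Q" for R
    proof -
      have "rename_rule ?g ` rename_rule ?f ` R = (\<lambda>r. r) ` R"
        unfolding image_image using inv T that by (intro image_cong) auto
      then show ?thesis by simp
    qed
    ultimately show ?thesis by simp
  qed
  with T' show "\<exists>g. T' = map g T \<and> (\<forall>P Q. set T = P \<union> Q \<longrightarrow>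
      strongly_equivalent (g ` P) (g ` Q) \<longrightarrow> strongly_equivalent P Q)"
    by (intro exI[of _ "rename_rule ?f"]) simp
qed

text \<open>This treats \<open>S_DL\<close> and \<open>S_RD 2\<close> together: two elements suffice
  to leave the deleted atom a twin.\<close>

lemma SE_preserving_delete:
  assumes "\<And>T T'. \<tau> T T' \<Longrightarrow> \<exists>N a. card (indep_set T N) \<ge> 2 \<and> a \<in> indep_set T N \<and>
    T' = delete_atom a T"
  shows "SE_preserving \<tau>"
proof (rule map_SE_preservingI)
  fix T T' assume "\<tau> T T'"
  then obtain N a where card: "card (indep_set T N) \<ge> 2" and a: "a \<in> indep_set T N"
    and T': "T' = map (delete_rule a) T"
    using assms[of T T'] by (auto simp: delete_atom_eq_map)
  have "\<not> indep_set T N \<subseteq> {a}"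
    using card_mono[of "{a}" "indep_set T N"] card by auto
  then obtain b where b: "b \<in> indep_set T N" "a \<noteq> b"
    by blast
  have "strongly_equivalent (delete_rule a ` P) (delete_rule a ` Q)"
    if "set T = P \<union> Q" "strongly_equivalent P Q" for P Q
  proof (rule strongly_equivalent_delete_twin[OF _ _ that(2) b(2)])
    show "finite P" "finite Q"
      using that(1) by (metis List.finite_set finite_Un)+
  qed (use that(1) a b(1) in \<open>auto intro: twin_if_indep_set\<close>)
  with T' show "\<exists>g. T' = map g T \<and> (\<forall>P Q. set T = P \<union> Q \<longrightarrow> strongly_equivalent P Q \<longrightarrow>
      strongly_equivalent (g ` P) (g ` Q))"
    by (intro exI[of _ "delete_rule a"]) simp
qed

lemma SE_preserving_S_DL: "SE_preserving S_DL"
  by (rule SE_preserving_delete) (force simp: S_DL_def)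

lemma SE_preserving_S_RD_2: "SE_preserving (S_RD 2)"
  by (rule SE_preserving_delete) (force simp: S_RD_def)

text \<open>Three elements supply the twins \<open>b\<close> and \<open>c\<close> that
  \<open>squeeze\<close> requires.\<close>

lemma NSE_preserving_S_DL: "NSE_preserving S_DL"
proof (rule map_NSE_preservingI)
  fix T T' :: "'a rules" assume "S_DL T T'"
  then obtain N a where card: "card (indep_set T N) > 2" and a: "a \<in> indep_set T N"
    and T': "T' = map (delete_rule a) T"
    by (auto simp: S_DL_def delete_atom_eq_map)
  have "\<not> indep_set T N \<subseteq> {a}"
    using card_mono[of "{a}" "indep_set T N"] card by auto
  then obtain b where b: "b \<in> indep_set T N" "a \<noteq> b"
    by blast
  then have "\<not> indep_set T N \<subseteq> {a, b}"
    using card_mono[of "{a, b}" "indep_set T N"] card by auto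
  then obtain c where c: "c \<in> indep_set T N" "a \<noteq> c" "b \<noteq> c"
    by blast
  have "strongly_equivalent P Q"
    if "set T = P \<union> Q" "strongly_equivalent (delete_rule a ` P) (delete_rule a ` Q)" for P Q
  proof (rule strongly_equivalent_of_delete_twins[OF _ _ that(2) b(2) c(2,3)])
    show "finite P" "finite Q"
      using that(1) by (metis List.finite_set finite_Un)+
  qed (use that(1) a b(1) c(1) in \<open>auto intro: twin_if_indep_set\<close>)
  with T' show "\<exists>g. T' = map g T \<and> (\<forall>P Q. set T = P \<union> Q \<longrightarrow>
      strongly_equivalent (g ` P) (g ` Q) \<longrightarrow> strongly_equivalent P Q)"
    by (intro exI[of _ "delete_rule a"]) simp
qed

text \<open>The same index set \<open>N\<close> serves for the way back, where its independent set
  is larger by one. Hence the size bounds shift by one: \<open>S_AD\<close> is undone by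
  \<open>S_DL\<close>, and \<open>S_EX i\<close> by \<open>S_RD (Suc i)\<close>.\<close>

lemma add_atom_is_delete_converse:
  assumes "index_set T N" "a \<notin> atoms T" "T' = add_atom a N T"
  shows "index_set T' N" "card (indep_set T' N) = Suc (card (indep_set T N))"
    "a \<in> indep_set T' N" "T = delete_atom a T'" "length T' = length T"
  unfolding assms(3) using assms(1,2) card_indep_set_add_atom[OF assms(2,1)]
  by (simp_all add: indep_set_add_atom delete_atom_add_atom) (simp add: index_set_def)

lemma S_AD_converse:
  assumes "S_AD T T'"
  shows "S_DL T' T \<and> length T' = length T"
proof -
  from assms obtain N a where *: "index_set T N" "a \<notin> atoms T" "T' = add_atom a N T"
    and card: "card (indep_set T N) \<ge> 2"
    unfolding S_AD_def by blast
  note conv = add_atom_is_delete_converse[OF *]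
  have "card (indep_set T' N) > 2"
    using conv(2) card by simp
  with conv show ?thesis
    unfolding S_DL_def by blast
qed

lemma S_EX_converse:
  assumes "S_EX i T T'"
  shows "S_RD (Suc i) T' T \<and> length T' = length T"
proof -
  from assms obtain N a where *: "index_set T N" "a \<notin> atoms T" "T' = add_atom a N T"
    and card: "card (indep_set T N) = i"
    unfolding S_EX_def by blast
  note conv = add_atom_is_delete_converse[OF *]
  have "card (indep_set T' N) = Suc i"
    using conv(2) card by simp
  with conv show ?thesis
    unfolding S_RD_def by blast
qed

lemma SE_preserving_S_AD: "SE_preserving S_AD"
  by (rule SE_preserving_converse[OF NSE_preserving_S_DL S_AD_converse])

lemma NSE_preserving_S_AD: "NSE_preserving S_AD"
  by (rule NSE_preserving_converse[OF SE_preserving_S_DL S_AD_converse])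

lemma NSE_preserving_S_EX_1: "NSE_preserving (S_EX 1)"
proof (rule NSE_preserving_converse[OF SE_preserving_S_RD_2])
  fix T T' :: "'a rules" assume "S_EX 1 T T'"
  then show "S_RD 2 T' T \<and> length T' = length T"
    using S_EX_converse[of 1 T T'] by (simp add: numeral_2_eq_2)
qed

section \<open>Counterexamples\<close>

lemma not_SE_preservingI:
  assumes "\<tau> (P @ Q) (P' @ Q')" "length P' = length P" "strongly_equivalent (set P) (set Q)"
    "\<not> strongly_equivalent (set P') (set Q')"
  shows "\<not> SE_preserving \<tau>"
  using assms unfolding SE_preserving_def
  by (metis append_eq_conv_conj)

lemma not_NSE_preservingI:
  assumes "\<tau> (P @ Q) (P' @ Q')" "length P' = length P" "\<not> strongly_equivalent (set P) (set Q)"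
    "strongly_equivalent (set P') (set Q')"
  shows "\<not> NSE_preserving \<tau>"
  using assms unfolding NSE_preserving_def
  by (metis append_eq_conv_conj)

lemmas se_model_simps = strongly_equivalent_iff_se_model se_model_def ht_rule_def sat_rule_def

abbreviation falsum :: "'a rule" where
  "falsum \<equiv> Rule {||} {||} {||}"

lemma fact_not_strongly_equivalent_falsum:
  "\<not> strongly_equivalent {Rule {|a|} {||} {||}} {falsum}"
  by (auto simp: se_model_simps)

lemma tautology_strongly_equivalent_empty: "strongly_equivalent {Rule {|a|} {|a|} {||}} {}"
  by (auto simp: se_model_simps)

lemma falsum_not_strongly_equivalent_empty: "\<not> strongly_equivalent {falsum} {}"
  by (auto simp: se_model_simps)

text \<open>Each \<open>Y\<close> violates one of the two constraints, according to whether it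
  contains \<open>a\<close>.\<close>

lemma excluded_middle_strongly_equivalent_falsum:
  "strongly_equivalent {Rule {||} {|a|} {||}, Rule {||} {||} {|a|}} {falsum}"
  by (auto simp: se_model_simps)

text \<open>Two atoms allow what a single one cannot: \<open>{a}\<close> neither contains nor avoids
  the pair, so it satisfies both constraints.\<close>

lemma split_pair_not_strongly_equivalent_falsum:
  assumes "a \<noteq> b"
  shows "\<not> strongly_equivalent {Rule {||} {|a, b|} {||}, Rule {||} {||} {|a, b|}} {falsum}"
proof -
  let ?P = "{Rule {||} {|a, b|} {||}, Rule {||} {||} {|a, b|}}"
  have "se_model ?P {a} {a}" "\<not> se_model {falsum} {a} {a}"
    using assms by (auto simp: se_model_simps)
  then show ?thesis
    by (auto simp: strongly_equivalent_iff_se_model)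
qed

lemmas indep_set_simps = indep_set_def index_set_def components_def atoms_def
  numeral_eq_Suc lessThan_Suc

lemma not_NSE_preserving_S_RD_2:
  assumes "a \<noteq> (b :: 'a)"
  shows "\<not> NSE_preserving (S_RD 2 :: 'a transformation)"
proof (rule not_NSE_preservingI)
  let ?T = "[Rule {||} {|a, b|} {||}, Rule {||} {||} {|a, b|}] @ [falsum]"
  \<comment> \<open>Index 1 is the positive body of the first rule, index 5 the negative body of the
    second.\<close>
  have "index_set ?T {1, 5}" "indep_set ?T {1, 5} = {a, b}"
    by (auto simp: indep_set_simps)
  moreover have
    "[Rule {||} {|a|} {||}, Rule {||} {||} {|a|}] @ [falsum] = delete_atom b ?T"
    using assms by (auto simp: delete_atom_def)
  ultimately show
    "S_RD 2 ?T ([Rule {||} {|a|} {||}, Rule {||} {||} {|a|}] @ [falsum])"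
    unfolding S_RD_def using assms by (intro exI[of _ "{1, 5}"] exI[of _ b]) simp
qed (use assms split_pair_not_strongly_equivalent_falsum
      excluded_middle_strongly_equivalent_falsum in simp_all)

text \<open>The counterexample for \<open>S_RD 2\<close> read backwards.\<close>

lemma not_SE_preserving_S_EX_1:
  assumes "a \<noteq> (b :: 'a)"
  shows "\<not> SE_preserving (S_EX 1 :: 'a transformation)"
proof (rule not_SE_preservingI)
  let ?T = "[Rule {||} {|a|} {||}, Rule {||} {||} {|a|}] @ [falsum]"
  have "index_set ?T {1, 5}" "indep_set ?T {1, 5} = {a}" "b \<notin> atoms ?T"
    using assms by (auto simp: indep_set_simps)
  moreover have
    "[Rule {||} {|b, a|} {||}, Rule {||} {||} {|b, a|}] @ [falsum] = add_atom b {1, 5} ?T"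
    by (simp add: add_atom_def)
  ultimately show
    "S_EX 1 ?T ([Rule {||} {|b, a|} {||}, Rule {||} {||} {|b, a|}] @ [falsum])"
    unfolding S_EX_def by (intro exI[of _ "{1, 5}"] exI[of _ b]) simp
qed (use assms split_pair_not_strongly_equivalent_falsum[of b a]
      excluded_middle_strongly_equivalent_falsum in simp_all)

text \<open>Removing its only atom turns a tautology into the unsatisfiable \<open>falsum\<close>,
  while the empty program stays as it is.\<close>

lemma not_SE_preserving_S_RD_1: "\<not> SE_preserving (S_RD 1)"
proof (rule not_SE_preservingI)
  fix a :: 'a
  let ?T = "[Rule {|a|} {|a|} {||}] @ []"
  have "index_set ?T {0, 1}" "indep_set ?T {0, 1} = {a}"
    by (auto simp: indep_set_simps)
  moreover have "[falsum] @ [] = delete_atom a ?T"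
    by (simp add: delete_atom_def)
  ultimately show "S_RD 1 ?T ([falsum] @ [])"
    unfolding S_RD_def by (intro exI[of _ "{0, 1}"] exI[of _ a]) simp
qed (use tautology_strongly_equivalent_empty falsum_not_strongly_equivalent_empty in simp_all)

text \<open>A fact loses its head and collapses to \<open>falsum\<close>, the program it was
  compared with.\<close>

lemma not_NSE_preserving_S_RD_1: "\<not> NSE_preserving (S_RD 1)"
proof (rule not_NSE_preservingI)
  fix a :: 'a
  let ?T = "[Rule {|a|} {||} {||}] @ [falsum]"
  have "index_set ?T {0}" "indep_set ?T {0} = {a}"
    by (auto simp: indep_set_simps)
  moreover have "[falsum] @ [falsum] = delete_atom a ?T"
    by (simp add: delete_atom_def)
  ultimately show "S_RD 1 ?T ([falsum] @ [falsum])"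
    unfolding S_RD_def by (intro exI[of _ "{0}"] exI[of _ a]) simp
qed (use fact_not_strongly_equivalent_falsum in \<open>simp_all add: strongly_equivalent_def\<close>)

lemma not_SE_preserving_S_EX_0: "\<not> SE_preserving (S_EX 0)"
proof (rule not_SE_preservingI)
  fix a :: 'a
  let ?T = "[falsum :: 'a rule] @ [falsum]"
  \<comment> \<open>Index 0 selects only the head of the first rule, so the two equal programs are
    treated differently.\<close>
  have "index_set ?T {0}" "indep_set ?T {0} = {}" "a \<notin> atoms ?T"
    by (auto simp: indep_set_simps)
  moreover have "[Rule {|a|} {||} {||}] @ [falsum] = add_atom a {0} ?T"
    by (simp add: add_atom_def)
  ultimately show "S_EX 0 ?T ([Rule {|a|} {||} {||}] @ [falsum])"
    unfolding S_EX_def by (intro exI[of _ "{0}"] exI[of _ a]) simp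
qed (use fact_not_strongly_equivalent_falsum in \<open>simp_all add: strongly_equivalent_def\<close>)

lemma not_NSE_preserving_S_EX_0: "\<not> NSE_preserving (S_EX 0)"
proof (rule not_NSE_preservingI)
  fix a :: 'a
  let ?T = "[falsum :: 'a rule] @ []"
  \<comment> \<open>Adding the atom to both head and positive body makes \<open>falsum\<close> a
    tautology, hence equivalent to the empty program.\<close>
  have "index_set ?T {0, 1}" "indep_set ?T {0, 1} = {}" "a \<notin> atoms ?T"
    by (auto simp: indep_set_simps)
  moreover have "[Rule {|a|} {|a|} {||}] @ [] = add_atom a {0, 1} ?T"
    by (simp add: add_atom_def)
  ultimately show "S_EX 0 ?T ([Rule {|a|} {|a|} {||}] @ [])"
    unfolding S_EX_def by (intro exI[of _ "{0, 1}"] exI[of _ a]) simp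
qed (use tautology_strongly_equivalent_empty falsum_not_strongly_equivalent_empty in simp_all)

theorem theorem7:
  assumes "infinite (UNIV :: 'a set)"
  shows "(SE_preserving (S_RP :: 'a transformation) \<and> NSE_preserving (S_RP :: 'a transformation) \<and>
          SE_preserving (S_DL :: 'a transformation) \<and> NSE_preserving (S_DL :: 'a transformation) \<and>
          SE_preserving (S_AD :: 'a transformation) \<and> NSE_preserving (S_AD :: 'a transformation)) \<and>
         (SE_preserving (S_RD 2 :: 'a transformation) \<and> \<not> NSE_preserving (S_RD 2 :: 'a transformation)) \<and>
         (NSE_preserving (S_EX 1 :: 'a transformation) \<and> \<not> SE_preserving (S_EX 1 :: 'a transformation)) \<and>
         (\<not> SE_preserving (S_RD 1 :: 'a transformation) \<and> \<not> NSE_preserving (S_RD 1 :: 'a transformation) \<and>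
          \<not> SE_preserving (S_EX 0 :: 'a transformation) \<and> \<not> NSE_preserving (S_EX 0 :: 'a transformation))"
proof -
  obtain a b :: 'a where "a \<noteq> b"
    using assms by (metis UNIV_eq_I finite.emptyI finite.insertI insertI1)
  show ?thesis
    by (intro conjI; fact SE_preserving_S_RP NSE_preserving_S_RP SE_preserving_S_DL
        NSE_preserving_S_DL SE_preserving_S_AD NSE_preserving_S_AD SE_preserving_S_RD_2
        not_NSE_preserving_S_RD_2[OF \<open>a \<noteq> b\<close>] NSE_preserving_S_EX_1
        not_SE_preserving_S_EX_1[OF \<open>a \<noteq> b\<close>] not_SE_preserving_S_RD_1 not_NSE_preserving_S_RD_1
        not_SE_preserving_S_EX_0 not_NSE_preserving_S_EX_0)
qed

end
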